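(* Let $P,Q\in C^{3}((0,\infty))\cap C([0,\infty))$ be nonnegative functions with $P'>0$ and $Q'>0$ on $(0,\infty)$, let $F:=Q\circ P^{-1}$, and suppose that both $P$ and $F$ satisfy the growth condition. Let $z\in\mathbb{C}$ with $|z|\le 1$, and suppose that $$Q^{-1}\left(\int_{\mathbb{R}^{k}} Q(|T_{z} f|)\, d\gamma \right) \leq P^{-1}\left(\int_{\mathbb{R}^{k}} P(|f|)\,d\gamma \right)$$ holds for all $k\ge1$ and all polynomials $f:\mathbb{R}^{k}\to\mathbb{C}$. Then $$\left|\frac{tP''(t)}{P'(t)}-z^{2}\frac{tQ''(t)}{Q'(t)}+z^{2}-1\right|\leq \frac{tP''(t)}{P'(t)}-|z|^{2}\frac{tQ''(t)}{Q'(t)}+1-|z|^{2}\qquad\text{for all } t>0.$$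
   Context: $d\gamma(x)=(2\pi)^{-k/2}e^{-|x|^2/2}\,dx$ is the standard Gaussian measure on $\mathbb{R}^k$. For a multiindex $\alpha\in(\mathbb{Z}_{\ge 0})^k$, $|\alpha|=\alpha_1+\dots+\alpha_k$ and $w^\alpha=w_1^{\alpha_1}\cdots w_k^{\alpha_k}$ for $w\in\mathbb{C}^k$; the (probabilist's) Hermite polynomials are $H_\alpha(x)=\int_{\mathbb{R}^k}(x+iy)^\alpha\,d\gamma(y)$. Every polynomial $f:\mathbb{R}^k\to\mathbb{C}$ (complex coefficients) has a unique expansion $f=\sum_{|\alpha|\le\deg f}c_\alpha H_\alpha$ with $c_\alpha\in\mathbb{C}$, and for $z\in\mathbb{C}$, $|z|\le1$, one sets $T_zf(x)=\sum_{|\alpha|\le \deg f}z^{|\alpha|}c_\alpha H_\alpha(x)$. Growth condition: a function $B\in C^2((0,\infty))$ satisfies the growth condition if there exist $N,R>0$ such that $|B''(t)|<\exp(\log^{N}(t+N))$ for all $t\ge R$ (where $\log^N(\cdot)=(\log(\cdot))^N$). Here $P^{-1},Q^{-1}$ are the inverse functions of the strictly increasing functions $P,Q$ on $[0,\infty)$. It is presupposed that $F=Q\circ P^{-1}$ is defined on $[0,\infty)$, i.e. that $P(0)=0$ and $P(t)\to\infty$ as $t\to\infty$. *)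

theory Defs
  imports "HOL-Probability.Probability"
begin

text \<open>
  The dimension \<open>k\<close> is quantified inside the statement, so points of \<open>\<real>\<^sup>k\<close> and \<open>\<complex>\<^sup>k\<close> are functions on
  \<open>nat\<close> of which only the coordinates \<open>i < k\<close> matter, and Lebesgue measure on \<open>\<real>\<^sup>k\<close> is
  \<open>Pi\<^sub>M {..<k} (\<lambda>_. lborel)\<close>.
\<close>

definition gauss :: "nat \<Rightarrow> (nat \<Rightarrow> real) measure" where
  "gauss k = density (Pi\<^sub>M {..<k} (\<lambda>_. lborel))
     (\<lambda>x. ennreal ((2 * pi) powr (- real k / 2) * exp (- (\<Sum>i<k. (x i)\<^sup>2) / 2)))"

definition mi_deg :: "nat \<Rightarrow> (nat \<Rightarrow> nat) \<Rightarrow> nat" where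
  "mi_deg k \<alpha> = (\<Sum>i<k. \<alpha> i)"

text \<open>Requiring \<open>\<alpha> i = 0\<close> for \<open>i \<ge> k\<close> gives every multiindex exactly one representative
  and makes \<open>mi_upto k d\<close> finite.\<close>

definition mi_upto :: "nat \<Rightarrow> nat \<Rightarrow> (nat \<Rightarrow> nat) set" where
  "mi_upto k d = {\<alpha>. (\<forall>i\<ge>k. \<alpha> i = 0) \<and> mi_deg k \<alpha> \<le> d}"

definition mi_power :: "nat \<Rightarrow> (nat \<Rightarrow> complex) \<Rightarrow> (nat \<Rightarrow> nat) \<Rightarrow> complex" where
  "mi_power k w \<alpha> = (\<Prod>i<k. w i ^ \<alpha> i)"

definition poly_fun_upto :: "nat \<Rightarrow> nat \<Rightarrow> ((nat \<Rightarrow> real) \<Rightarrow> complex) \<Rightarrow> bool" where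
  "poly_fun_upto k d f \<longleftrightarrow>
     (\<exists>a. f = (\<lambda>x. \<Sum>\<alpha>\<in>mi_upto k d. a \<alpha> * mi_power k (\<lambda>i. of_real (x i)) \<alpha>))"

definition poly_fun :: "nat \<Rightarrow> ((nat \<Rightarrow> real) \<Rightarrow> complex) \<Rightarrow> bool" where
  "poly_fun k f \<longleftrightarrow> (\<exists>d. poly_fun_upto k d f)"

definition poly_fun_degree :: "nat \<Rightarrow> ((nat \<Rightarrow> real) \<Rightarrow> complex) \<Rightarrow> nat" where
  "poly_fun_degree k f = (LEAST d. poly_fun_upto k d f)"

definition hermite :: "nat \<Rightarrow> (nat \<Rightarrow> nat) \<Rightarrow> (nat \<Rightarrow> real) \<Rightarrow> complex" where
  "hermite k \<alpha> x =
     (\<integral>y. mi_power k (\<lambda>i. of_real (x i) + \<i> * of_real (y i)) \<alpha> \<partial>gauss k)"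

definition hermite_coeff :: "nat \<Rightarrow> ((nat \<Rightarrow> real) \<Rightarrow> complex) \<Rightarrow> (nat \<Rightarrow> nat) \<Rightarrow> complex" where
  "hermite_coeff k f = (THE c.
     (\<forall>\<alpha>. \<alpha> \<notin> mi_upto k (poly_fun_degree k f) \<longrightarrow> c \<alpha> = 0) \<and>
     f = (\<lambda>x. \<Sum>\<alpha>\<in>mi_upto k (poly_fun_degree k f). c \<alpha> * hermite k \<alpha> x))"

definition T_op :: "nat \<Rightarrow> complex \<Rightarrow> ((nat \<Rightarrow> real) \<Rightarrow> complex) \<Rightarrow> (nat \<Rightarrow> real) \<Rightarrow> complex" where
  "T_op k z f x = (\<Sum>\<alpha>\<in>mi_upto k (poly_fun_degree k f).
     z ^ mi_deg k \<alpha> * hermite_coeff k f \<alpha> * hermite k \<alpha> x)"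

text \<open>\<open>f \<in> C\<^sup>n(S)\<close>, for open \<open>S\<close>.\<close>

definition C_on :: "nat \<Rightarrow> (real \<Rightarrow> real) \<Rightarrow> real set \<Rightarrow> bool" where
  "C_on n f S \<longleftrightarrow>
     (\<forall>j<n. \<forall>t\<in>S. (deriv ^^ j) f field_differentiable at t) \<and> continuous_on S ((deriv ^^ n) f)"

text \<open>\<open>N\<close> is real. Since \<open>R\<close> may be enlarged, the values of \<open>powr\<close> at a negative base
  (where \<open>t + N < 1\<close>) do not affect the predicate.\<close>

definition growth_condition :: "(real \<Rightarrow> real) \<Rightarrow> bool" where
  "growth_condition B \<longleftrightarrow> C_on 2 B {0<..} \<and>
     (\<exists>N>0. \<exists>R>0. \<forall>t\<ge>R. \<bar>deriv (deriv B) t\<bar> < exp (ln (t + N) powr N))"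

end

theory Submission
  imports Defs "HOL-Real_Asymp.Real_Asymp"
begin

text \<open>
  The hypothesis already yields the conclusion when it is tested on one-dimensional affine
  polynomials \<open>f(x) = t + (b/n) x\<close> with \<open>t > 0\<close>, \<open>|b| = 1\<close> and \<open>n \<rightarrow> \<infinity>\<close>. Since \<open>1\<close> and \<open>x\<close> are Hermite
  polynomials, \<open>T\<^sub>z f(x) = t + (z b/n) x\<close> (\<open>T_op_affine\<close>), so both sides of the hypothesis are
  instances of one quantity, the generalized mean \<open>M\<^sub>G(w/n) = G\<inverse>(E G(|t + (w/n) X|))\<close> with \<open>X\<close>
  standard Gaussian, for \<open>G = P, w = b\<close> and for \<open>G = Q, w = z b\<close>.

  The modulus expands as \<open>|t + s w| = t + s Re w + s\<^sup>2 (Im w)\<^sup>2/(2t) + o(s\<^sup>2)\<close>. Composing with \<open>G\<close>,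
  taking expectations (\<open>E X = 0\<close>, \<open>E X\<^sup>2 = 1\<close>) and applying the inverse of \<open>G\<close>, whose derivative
  at \<open>G t\<close> is \<open>1/G' t\<close>, gives
  \<open>n\<^sup>2 (M\<^sub>G(w/n) - t) \<longlonglongrightarrow> (g (Re w)\<^sup>2 + (Im w)\<^sup>2)/(2t)\<close> where \<open>g = t G''(t)/G'(t)\<close>
  (\<open>inv_gauss_second_order\<close>). Hence, with \<open>p\<close> and \<open>q\<close> the values of \<open>g\<close> for \<open>P\<close> and \<open>Q\<close>,
  \<open>q (Re (z b))\<^sup>2 + (Im (z b))\<^sup>2 \<le> p (Re b)\<^sup>2 + (Im b)\<^sup>2\<close> for all unimodular \<open>b\<close>.
  Writing \<open>2 (Re w)\<^sup>2 = |w|\<^sup>2 + Re w\<^sup>2\<close> and \<open>2 (Im w)\<^sup>2 = |w|\<^sup>2 - Re w\<^sup>2\<close>, this says that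
  \<open>Re (b\<^sup>2 A) \<ge> -r\<close> with \<open>A = p - z\<^sup>2 q + z\<^sup>2 - 1\<close> and \<open>r = p - |z|\<^sup>2 q + 1 - |z|\<^sup>2\<close>; letting \<open>b\<^sup>2\<close> point
  opposite to the conjugate of \<open>A\<close> gives \<open>|A| \<le> r\<close> (\<open>quadratic_forms_imp_norm_le\<close>).

  The expectation is expanded by dominated convergence. It requires \<open>G(|t + s w|)\<close> to grow at
  most exponentially in \<open>s\<close>, and this is where the growth condition enters: it gives
  \<open>P t \<le> exp (log\<^sup>K t)\<close> and \<open>F t \<le> exp (log\<^sup>L t)\<close> for large \<open>t\<close>. Functions of this kind are closed
  under composition, so \<open>Q = F \<circ> P\<close> is also eventually bounded by \<open>exp t\<close>.
\<close>

section \<open>The standard Gaussian measure on the line\<close>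

text \<open>The dimension is the numeral \<open>1\<close> up to the end of this section and the next; it must not
  be rewritten to a successor, or the rules about \<open>gauss 1\<close> and \<open>mi_upto 1\<close> would not apply.\<close>

declare One_nat_def [simp del]

lemma lessThan_one_nat [simp]: "{..<1::nat} = {0}"
  by auto

abbreviation std_gauss :: "real measure" where
  "std_gauss \<equiv> density lborel (\<lambda>x. ennreal (std_normal_density x))"

interpretation std_gauss: prob_space std_gauss
  by (rule prob_space_normal_density) simp

text \<open>
  The first coordinate of a point of the one-dimensional space is standard normal, which moves all
  integrals to the real line.
\<close>

lemma distr_gauss_1: "distr (gauss 1) borel (\<lambda>x. x 0) = std_gauss"
proof -
  interpret product_sigma_finite "\<lambda>_::nat. lborel :: real measure" ..
  have "gauss 1 = density (Pi\<^sub>M {0} (\<lambda>_. lborel)) (\<lambda>x. ennreal (std_normal_density (x 0)))"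
    unfolding gauss_def lessThan_one_nat
    by (intro arg_cong2[where f = density] ext refl)
       (simp add: normal_density_def powr_minus powr_half_sqrt field_simps)
  moreover have "distr (Pi\<^sub>M {0::nat} (\<lambda>_. lborel :: real measure)) borel (\<lambda>x. x 0) = lborel"
    using distr_singleton[of 0] by (simp cong: distr_cong)
  ultimately show ?thesis
    using density_distr[of "\<lambda>x. ennreal (std_normal_density x)" borel "\<lambda>x. x 0"
        "Pi\<^sub>M {0::nat} (\<lambda>_. lborel :: real measure)"] by simp
qed

lemma integral_gauss_1:
  fixes g :: "real \<Rightarrow> 'a :: {banach, second_countable_topology}"
  assumes [measurable]: "g \<in> borel_measurable borel"
  shows "(\<integral>x. g (x 0) \<partial>gauss 1) = integral\<^sup>L std_gauss g"
proof -
  have [measurable]: "(\<lambda>x. x 0) \<in> measurable (gauss 1) borel"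
    unfolding gauss_def by simp
  show ?thesis unfolding distr_gauss_1[symmetric] by (rule integral_distr[symmetric]) measurable
qed

text \<open>
  Completing the square: \<open>exp (c x)\<close> times the standard density is a multiple of the normal
  density with mean \<open>c\<close>.
\<close>

lemma integrable_exp_std_gauss: "integrable std_gauss (\<lambda>x. exp (c * x))"
proof -
  have "integrable lborel (\<lambda>x. exp (c\<^sup>2 / 2) * normal_density c 1 x)"
    by (intro integrable_mult_right integrable_normal_density) simp
  also have "(\<lambda>x. exp (c\<^sup>2 / 2) * normal_density c 1 x) = (\<lambda>x. std_normal_density x * exp (c * x))"
    by (auto simp: normal_density_def fun_eq_iff exp_add[symmetric] power2_eq_square field_simps
        simp flip: exp_add)
  finally show ?thesis by (simp add: integrable_density)
qed

lemma integrable_exp_abs_std_gauss: "integrable std_gauss (\<lambda>x. exp (c * \<bar>x\<bar>))"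
proof (rule Bochner_Integration.integrable_bound)
  show "integrable std_gauss (\<lambda>x. exp (c * x) + exp ((-c) * x))"
    by (intro Bochner_Integration.integrable_add integrable_exp_std_gauss)
  have "exp (c * \<bar>x\<bar>) \<le> exp (c * x) + exp ((-c) * x)" for x
    by (simp add: abs_if)
  then show "AE x in std_gauss. norm (exp (c * \<bar>x\<bar>)) \<le> norm (exp (c * x) + exp ((-c) * x))"
    by (intro AE_I2) simp
qed simp

lemma std_gauss_moments:
  "integrable std_gauss (\<lambda>x. x)" "(\<integral>x. x \<partial>std_gauss) = 0"
  "(\<integral>x. x\<^sup>2 \<partial>std_gauss) = 1"
  using integrable_std_normal_moment[of 1]
    integral_std_normal_moment_odd[of 0] integral_std_normal_moment_even[of 1]
  by (simp_all add: integrable_density integral_density)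

section \<open>Affine polynomials and their Hermite expansion\<close>

definition unit_mi :: "nat \<Rightarrow> nat" where
  "unit_mi = (\<lambda>_. 0)(0 := 1)"

lemma unit_mi_simps [simp]: "unit_mi 0 = 1" "i \<noteq> 0 \<Longrightarrow> unit_mi i = 0"
    "unit_mi \<noteq> (\<lambda>_. 0)" "(\<lambda>_. 0) \<noteq> unit_mi"
  by (auto simp: unit_mi_def dest: fun_cong[of _ _ 0])

lemma mi_upto_1_0: "mi_upto 1 0 = {\<lambda>_. 0}"
proof -
  have "\<alpha> = (\<lambda>_. 0)" if "\<forall>i\<ge>1. \<alpha> i = 0" "\<alpha> 0 = 0" for \<alpha> :: "nat \<Rightarrow> nat"
  proof
    fix i show "\<alpha> i = 0" using that by (cases "i = 0") auto
  qed
  then show ?thesis unfolding mi_upto_def mi_deg_def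
    by (intro set_eqI iffI) auto
qed

lemma mi_upto_1_1: "mi_upto 1 1 = {\<lambda>_. 0, unit_mi}" (is "_ = {?u, ?e}")
proof -
  have cases: "\<alpha> = ?u \<or> \<alpha> = ?e" if "\<forall>i\<ge>1. \<alpha> i = 0" "\<alpha> 0 \<le> 1" for \<alpha>
  proof -
    have "\<alpha> i = 0" if "i \<noteq> 0" for i
      using \<open>\<forall>i\<ge>1. \<alpha> i = 0\<close> that by simp
    moreover have "\<alpha> 0 = 0 \<or> \<alpha> 0 = 1" using that by linarith
    ultimately show ?thesis by (metis ext unit_mi_simps(1,2))
  qed
  then show ?thesis unfolding mi_upto_def mi_deg_def
    by (intro set_eqI iffI) (simp, auto)
qed

lemma sum_mi_upto_1_1:
  "(\<Sum>\<alpha>\<in>mi_upto 1 1. g \<alpha>) = g (\<lambda>_. 0) + g (unit_mi)" for g :: "_ \<Rightarrow> complex"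
  unfolding mi_upto_1_1 by simp

lemma hermite_1_0: "hermite 1 (\<lambda>_. 0) x = 1"
  using integral_gauss_1[of "\<lambda>_. 1 :: complex"] std_gauss.prob_space
  by (simp add: hermite_def mi_power_def)

text \<open>
  The imaginary part of \<open>x + i y\<close> has mean zero.
\<close>

lemma hermite_1_1: "hermite 1 (unit_mi) x = of_real (x 0)"
proof -
  have i: "integrable std_gauss (\<lambda>y. \<i> * of_real y)"
    by (intro integrable_mult_right integrable_of_real std_gauss_moments)
  have "hermite 1 (unit_mi) x = (\<integral>y. of_real (x 0) + \<i> * of_real y \<partial>std_gauss)"
    using integral_gauss_1[of "\<lambda>y. of_real (x 0) + \<i> * of_real y"]
    by (simp add: hermite_def mi_power_def)
  also have "\<dots> = of_real (x 0) + (\<integral>y. \<i> * of_real y \<partial>std_gauss)"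
    using std_gauss.prob_space i by (subst Bochner_Integration.integral_add) auto
  also have "(\<integral>y. \<i> * of_real y \<partial>std_gauss) = 0"
    using std_gauss_moments(2) by simp
  finally show ?thesis by simp
qed

lemma affine_is_poly_fun: "poly_fun_upto 1 1 (\<lambda>x. A + B * of_real (x 0))"
  unfolding poly_fun_upto_def sum_mi_upto_1_1
  by (rule exI[of _ "\<lambda>\<alpha>. if \<alpha> 0 = 0 then A else B"]) (simp add: mi_power_def)

text \<open>
  Here \<open>B \<noteq> 0\<close> makes the degree exactly 1. The definite description of the coefficients is resolved
  by comparing the two sides at the points 0 and 1.
\<close>

lemma T_op_affine:
  assumes "B \<noteq> 0"
  shows "T_op 1 z (\<lambda>x. A + B * of_real (x 0)) x = A + z * B * of_real (x 0)"
proof -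
  let ?f = "\<lambda>x::nat \<Rightarrow> real. A + B * of_real (x 0)"
  have affine_eqD: "A' = A \<and> B' = B" if "?f = (\<lambda>x. A' + B' * of_real (x 0))" for A' B'
    using fun_cong[OF that, of "\<lambda>_. 0"] fun_cong[OF that, of "\<lambda>_. 1"] by simp
  have deg: "poly_fun_degree 1 ?f = 1" unfolding poly_fun_degree_def
  proof (rule Least_equality)
    show "poly_fun_upto 1 1 ?f" by (rule affine_is_poly_fun)
    fix d assume d: "poly_fun_upto 1 d ?f"
    have "\<not> poly_fun_upto 1 0 ?f"
    proof
      assume "poly_fun_upto 1 0 ?f"
      then obtain a where "?f = (\<lambda>x. a (\<lambda>_. 0) + 0 * of_real (x 0))"
        unfolding poly_fun_upto_def mi_upto_1_0 by (auto simp: mi_power_def)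
      from affine_eqD[OF this] \<open>B \<noteq> 0\<close> show False by simp
    qed
    with d show "1 \<le> d" by (cases d) auto
  qed
  have coeff: "hermite_coeff 1 ?f =
      (\<lambda>\<alpha>. if \<alpha> = (\<lambda>_. 0) then A else if \<alpha> = unit_mi then B else 0)" (is "_ = ?c")
    unfolding hermite_coeff_def deg
  proof (rule the_equality)
    show "(\<forall>\<alpha>. \<alpha> \<notin> mi_upto 1 1 \<longrightarrow> ?c \<alpha> = 0) \<and> ?f = (\<lambda>x. \<Sum>\<alpha>\<in>mi_upto 1 1. ?c \<alpha> * hermite 1 \<alpha> x)"
      unfolding sum_mi_upto_1_1 hermite_1_0 hermite_1_1
      by (simp add: mi_upto_1_1)
    fix c assume c: "(\<forall>\<alpha>. \<alpha> \<notin> mi_upto 1 1 \<longrightarrow> c \<alpha> = 0) \<and>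
      ?f = (\<lambda>x. \<Sum>\<alpha>\<in>mi_upto 1 1. c \<alpha> * hermite 1 \<alpha> x)"
    then have "c (\<lambda>_. 0) = A \<and> c (unit_mi) = B"
      unfolding sum_mi_upto_1_1 hermite_1_0 hermite_1_1
      by (intro affine_eqD) simp
    then show "c = ?c" using conjunct1[OF c] unfolding mi_upto_1_1 by (intro ext) simp
  qed
  then show ?thesis
    unfolding T_op_def deg sum_mi_upto_1_1 hermite_1_0 hermite_1_1 coeff
    by (simp add: mi_deg_def)
qed

declare One_nat_def [simp]

section \<open>Consequences of the growth condition\<close>

lemma C_on_derivs:
  assumes "C_on n f S" "n \<ge> 2" "t \<in> S"
  shows "(f has_real_derivative deriv f t) (at t)"
    and "(deriv f has_real_derivative deriv (deriv f) t) (at t)"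
proof -
  have *: "(deriv ^^ j) f field_differentiable at t" if "j < n" for j
    using assms that unfolding C_on_def by blast
  show "(f has_real_derivative deriv f t) (at t)"
    using *[of 0] assms(2) by (simp add: field_differentiable_derivI)
  show "(deriv f has_real_derivative deriv (deriv f) t) (at t)"
    using *[of 1] assms(2) by (simp add: field_differentiable_derivI)
qed

text \<open>
  Enlarging the exponent absorbs the shift by \<open>N\<close>, and enlarging it once more absorbs the
  polynomial factor \<open>t\<^sup>2\<close> that integrating the second derivative twice produces.
\<close>

lemma growth_condition_imp_bound:
  assumes "growth_condition B"
  obtains K where "K > 0" "eventually (\<lambda>t. B t \<le> exp (ln t powr K)) at_top"
proof -
  from assms obtain N R where C2: "C_on 2 B {0<..}" and N: "N > 0" and R: "R > 0"
    and bd: "\<And>t. t \<ge> R \<Longrightarrow> \<bar>deriv (deriv B) t\<bar> < exp (ln (t + N) powr N)"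
    unfolding growth_condition_def by blast
  \<comment> \<open>Exponent \<open>N + 1\<close> serves for the second derivative, and \<open>N + 2\<close> for the function itself.\<close>
  define M where "M = N + 1"
  have M: "M > 1" using N by (simp add: M_def)
  have D: "(deriv B has_real_derivative deriv (deriv B) t) (at t)"
    "(B has_real_derivative deriv B t) (at t)" if "t > 0" for t
    using C_on_derivs[OF C2] that by auto
  have "eventually (\<lambda>t. ln (t + N) powr N \<le> ln t powr M) at_top"
    using N unfolding M_def by real_asymp
  then obtain T0 where T0: "\<And>t. t \<ge> T0 \<Longrightarrow> ln (t + N) powr N \<le> ln t powr M"
    unfolding eventually_at_top_linorder by blast
  define T where "T = max (max T0 R) 1"
  have T: "T \<ge> T0" "T \<ge> R" "T \<ge> 1" by (auto simp: T_def)
  have step: "B t \<le> (\<bar>B T\<bar> + 1) + (t - T) * ((\<bar>deriv B T\<bar> + 1) + (t - T) * exp (ln t powr M))" if "t > T" for t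
  proof -
    have "\<exists>u>T. u < t \<and> B t - B T = (t - T) * deriv B u"
      by (rule MVT2) (use that D(2) T(3) in auto)
    then obtain u where u: "T < u" "u < t" "B t - B T = (t - T) * deriv B u" by blast
    have "\<exists>v>T. v < u \<and> deriv B u - deriv B T = (u - T) * deriv (deriv B) v"
      by (rule MVT2) (use u D(1) T(3) in auto)
    then obtain v where v: "T < v" "v < u" "deriv B u - deriv B T = (u - T) * deriv (deriv B) v"
      by blast
    have "deriv (deriv B) v \<le> exp (ln (v + N) powr N)"
      using bd[of v] v T by simp
    also have "\<dots> \<le> exp (ln v powr M)" using T0[of v] v T by simp
    also have "\<dots> \<le> exp (ln t powr M)" using u v T M by (auto intro!: powr_mono2)
    finally have "(u - T) * deriv (deriv B) v \<le> (t - T) * exp (ln t powr M)"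
      using u v by (intro order.trans[OF mult_left_mono mult_right_mono]) auto
    then have "deriv B u \<le> (\<bar>deriv B T\<bar> + 1) + (t - T) * exp (ln t powr M)" using v by linarith
    then have "(t - T) * deriv B u \<le> (t - T) * ((\<bar>deriv B T\<bar> + 1) + (t - T) * exp (ln t powr M))"
      using that by (intro mult_left_mono) auto
    then show ?thesis using u by linarith
  qed
  have "eventually (\<lambda>t. a + (t - T) * (b + (t - T) * exp (ln t powr M)) \<le> exp (ln t powr (M + 1))) at_top"
    if "a > 0" "b > 0" for a b
  proof -
    have "eventually (\<lambda>t. t ^ 3 * exp (ln t powr M) \<le> exp (ln t powr (M + 1))) at_top"
      using M by real_asymp
    with eventually_ge_at_top[of T] eventually_ge_at_top[of "a + b + 1"] show ?thesis
    proof eventually_elim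
      case (elim t)
      let ?E = "exp (ln t powr M)"
      have t: "t \<ge> 1" and E: "?E \<ge> 1" using elim T by auto
      have "a + (t - T) * (b + (t - T) * ?E) \<le> a + t * (b + t * ?E)"
        using elim T that by (intro add_left_mono mult_mono add_mono) auto
      also have "\<dots> \<le> a * (t\<^sup>2 * ?E) + t * (b * (t * ?E) + t * ?E)"
      proof -
        have "1 \<le> t\<^sup>2 * ?E" "1 \<le> t * ?E"
          using mult_mono[OF one_le_power[OF t, of 2] E] mult_mono[OF t E] t by simp_all
        then show ?thesis using t that by (intro add_mono mult_left_mono) (simp_all add: mult_le_cancel_left1)
      qed
      also have "\<dots> = (a + b + 1) * (t\<^sup>2 * ?E)" by (simp add: algebra_simps power2_eq_square)
      also have "\<dots> \<le> t * (t\<^sup>2 * ?E)" using elim by (intro mult_right_mono) auto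
      also have "\<dots> = t ^ 3 * ?E" by (simp add: power2_eq_square power3_eq_cube)
      finally show ?case using elim by linarith
    qed
  qed
  from this[of "\<bar>B T\<bar> + 1" "\<bar>deriv B T\<bar> + 1"]
  have "eventually (\<lambda>t. \<bar>B T\<bar> + 1 + (t - T) * (\<bar>deriv B T\<bar> + 1 + (t - T) * exp (ln t powr M))
      \<le> exp (ln t powr (M + 1))) at_top" by simp
  with eventually_gt_at_top[of T]
  have "eventually (\<lambda>t. B t \<le> exp (ln t powr (M + 1))) at_top"
    by eventually_elim (use step in fastforce)
  with that[of "M + 1"] M show thesis by simp
qed

lemma abs_le_const_mult_exp:
  assumes cont: "continuous_on {0..} G" and ev: "eventually (\<lambda>t. G t \<le> exp t) at_top"
    and nonneg: "\<And>t. t \<ge> 0 \<Longrightarrow> G t \<ge> (0::real)"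
  obtains C where "\<And>t. t \<ge> 0 \<Longrightarrow> \<bar>G t\<bar> \<le> C * exp t" "C \<ge> 0"
proof -
  from ev obtain T where T: "\<And>t. t \<ge> T \<Longrightarrow> G t \<le> exp t"
    unfolding eventually_at_top_linorder by blast
  have "compact (G ` {0..T})"
    by (intro compact_continuous_image continuous_on_subset[OF cont]) auto
  then have "bounded (G ` {0..T})" by (rule compact_imp_bounded)
  then obtain K where K: "\<And>t. t \<in> {0..T} \<Longrightarrow> \<bar>G t\<bar> \<le> K"
    unfolding bounded_iff real_norm_def by (meson imageI)
  have "\<bar>G t\<bar> \<le> max 1 K * exp t" if "t \<ge> 0" for t
  proof (cases "t \<le> T")
    case True
    then have "\<bar>G t\<bar> \<le> max 1 K * 1" using K that by force
    also have "\<dots> \<le> max 1 K * exp t" using that by (intro mult_left_mono) auto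
    finally show ?thesis .
  next
    case False
    then have "\<bar>G t\<bar> \<le> 1 * exp t" using T nonneg that by simp
    also have "\<dots> \<le> max 1 K * exp t" by (intro mult_right_mono) auto
    finally show ?thesis .
  qed
  moreover have "max 1 K \<ge> 0" by (rule max.coboundedI1[OF zero_le_one])
  ultimately show thesis by (rule that)
qed

lemma growth_condition_imp_le_exp:
  assumes "growth_condition P"
  shows "eventually (\<lambda>t. P t \<le> exp t) at_top"
proof -
  obtain K where K: "K > 0" "eventually (\<lambda>t. P t \<le> exp (ln t powr K)) at_top"
    using growth_condition_imp_bound[OF assms] .
  have "eventually (\<lambda>t. ln t powr K \<le> t) at_top"
    using K(1) by real_asymp
  with K(2) show ?thesis
  proof eventually_elim
    case (elim t)
    then have "exp (ln t powr K) \<le> exp t" by simp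
    with elim show ?case by linarith
  qed
qed

text \<open>
  Bounds \<open>exp (log\<^sup>K t)\<close> and \<open>exp (log\<^sup>L t)\<close> compose to \<open>exp (log\<^sup>K\<^sup>L t)\<close>. Exponential
  bounds alone would not suffice here, because they are not closed under composition.
\<close>

lemma growth_condition_comp_le_exp:
  assumes F: "growth_condition F" and P: "growth_condition P" and lim: "filterlim P at_top at_top"
  shows "eventually (\<lambda>t. F (P t) \<le> exp t) at_top"
proof -
  obtain K where K: "K > 0" "eventually (\<lambda>t. P t \<le> exp (ln t powr K)) at_top"
    using growth_condition_imp_bound[OF P] .
  obtain L where L: "L > 0" "eventually (\<lambda>t. F t \<le> exp (ln t powr L)) at_top"
    using growth_condition_imp_bound[OF F] .
  have powr_le: "eventually (\<lambda>t. ln t powr e \<le> t) at_top" if "e > 0" for e :: real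
    using that by real_asymp
  have "eventually (\<lambda>t. F (P t) \<le> exp (ln (P t) powr L)) at_top"
    using L(2) lim by (rule eventually_compose_filterlim)
  moreover have "eventually (\<lambda>t. P t \<ge> 1) at_top"
    using lim by (simp add: filterlim_at_top)
  moreover have "eventually (\<lambda>t. ln t powr (K * L) \<le> t) at_top"
    using K(1) L(1) by (intro powr_le mult_pos_pos)
  ultimately show ?thesis using K(2)
  proof eventually_elim
    case (elim t)
    have "ln (P t) \<le> ln (exp (ln t powr K))" using elim by (subst ln_le_cancel_iff) auto
    then have "ln (P t) powr L \<le> (ln t powr K) powr L"
      using elim L by (intro powr_mono2) auto
    then have "exp (ln (P t) powr L) \<le> exp t" using elim by (simp add: powr_powr)
    with elim show ?case by linarith
  qed
qed

section \<open>Second-order expansion of Gaussian expectations\<close>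

text \<open>
  Taylor's formula with Peano remainder. Only differentiability of the derivative at the single
  point 0 is required, so the second derivative of \<open>s \<mapsto> G(|t + s b|)\<close> is computed only there.
\<close>

lemma second_order_peano:
  fixes \<phi> \<phi>' :: "real \<Rightarrow> real"
  assumes D1: "eventually (\<lambda>s. (\<phi> has_real_derivative \<phi>' s) (at s)) (nhds 0)"
    and D2: "(\<phi>' has_real_derivative c) (at 0)"
  shows "((\<lambda>s. (\<phi> s - \<phi> 0 - \<phi>' 0 * s) / s\<^sup>2) \<longlongrightarrow> c / 2) (at 0)"
proof (rule lhopital)
  have "(\<phi> has_real_derivative \<phi>' 0) (at 0)" using D1 by (rule eventually_nhds_x_imp_x)
  then have "(\<phi> \<longlongrightarrow> \<phi> 0) (at 0)" by (auto dest: DERIV_isCont simp: isCont_def)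
  then have "((\<lambda>s. \<phi> s - \<phi> 0 - \<phi>' 0 * s) \<longlongrightarrow> \<phi> 0 - \<phi> 0 - \<phi>' 0 * 0) (at 0)"
    by (intro tendsto_intros)
  then show "((\<lambda>s. \<phi> s - \<phi> 0 - \<phi>' 0 * s) \<longlongrightarrow> 0) (at 0)" by simp
  have "((\<lambda>s::real. s\<^sup>2) \<longlongrightarrow> 0\<^sup>2) (at 0)" by (intro tendsto_intros)
  then show "((\<lambda>s::real. s\<^sup>2) \<longlongrightarrow> 0) (at 0)" by simp
  show "eventually (\<lambda>s::real. s\<^sup>2 \<noteq> 0) (at 0)" "eventually (\<lambda>s::real. 2 * s \<noteq> 0) (at 0)"
    by (auto simp: eventually_at_filter)
  have "eventually (\<lambda>s. (\<phi> has_real_derivative \<phi>' s) (at s)) (at 0)"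
    using D1 by (simp add: eventually_at_filter eventually_mono)
  then show "eventually (\<lambda>s. ((\<lambda>s. \<phi> s - \<phi> 0 - \<phi>' 0 * s) has_real_derivative (\<phi>' s - \<phi>' 0)) (at s)) (at 0)"
    by eventually_elim (auto intro!: derivative_eq_intros)
  show "eventually (\<lambda>s::real. ((\<lambda>s. s\<^sup>2) has_real_derivative 2 * s) (at s)) (at 0)"
    by (auto intro!: always_eventually derivative_eq_intros)
  have "((\<lambda>s. (\<phi>' s - \<phi>' 0) / (s - 0) / 2) \<longlongrightarrow> c / 2) (at 0)"
    using D2 unfolding has_field_derivative_iff by (intro tendsto_intros) auto
  then show "((\<lambda>s. (\<phi>' s - \<phi>' 0) / (2 * s)) \<longlongrightarrow> c / 2) (at 0)"
    by (simp add: field_simps)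
qed

lemma square_le_exp_abs: "x\<^sup>2 \<le> 2 * exp \<bar>x :: real\<bar>"
  using exp_lower_Taylor_quadratic[of "\<bar>x\<bar>"] by simp

text \<open>
  Near 0 the remainder is quadratic by the limit, and away from 0 the factor \<open>s\<^sup>2\<close> is bounded below,
  so a single bound serves as the dominating function for all scalings of the argument at once.
\<close>

lemma remainder_bound:
  fixes \<phi> :: "real \<Rightarrow> real"
  assumes lim: "((\<lambda>s. (\<phi> s - \<phi> 0 - a * s) / s\<^sup>2) \<longlongrightarrow> l) (at 0)"
    and bound: "\<And>s. \<bar>\<phi> s\<bar> \<le> C * exp \<bar>s\<bar>"
  obtains K where "\<And>s. \<bar>\<phi> s - \<phi> 0 - a * s\<bar> \<le> K * s\<^sup>2 * exp \<bar>s\<bar>" "K \<ge> 0"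
proof -
  have "eventually (\<lambda>s. \<bar>(\<phi> s - \<phi> 0 - a * s) / s\<^sup>2\<bar> < \<bar>l\<bar> + 1) (at 0)"
    by (intro order_tendstoD(2)[OF tendsto_rabs[OF lim]]) simp
  then obtain d where d: "d > 0"
    "\<And>s. s \<noteq> 0 \<Longrightarrow> \<bar>s\<bar> < d \<Longrightarrow> \<bar>(\<phi> s - \<phi> 0 - a * s) / s\<^sup>2\<bar> < \<bar>l\<bar> + 1"
    unfolding eventually_at by (auto simp: dist_real_def)
  have C: "C \<ge> 0" using bound[of 0] by simp
  define c where "c = C + \<bar>\<phi> 0\<bar> + \<bar>a\<bar>"
  define K where "K = (\<bar>l\<bar> + 1) + c / d\<^sup>2"
  have c: "c \<ge> 0" using C by (simp add: c_def)
  have "\<bar>\<phi> s - \<phi> 0 - a * s\<bar> \<le> K * s\<^sup>2 * exp \<bar>s\<bar>" for s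
  proof -
    consider "s = 0" | "s \<noteq> 0" "\<bar>s\<bar> < d" | "\<bar>s\<bar> \<ge> d" by linarith
    then show ?thesis
    proof cases
      case 1 then show ?thesis by simp
    next
      case 2
      then have "\<bar>\<phi> s - \<phi> 0 - a * s\<bar> \<le> (\<bar>l\<bar> + 1) * s\<^sup>2 * 1"
        using d(2)[of s] by (simp add: abs_divide divide_less_eq)
      also have "\<dots> \<le> K * s\<^sup>2 * exp \<bar>s\<bar>"
        using c by (intro mult_mono) (auto simp: K_def)
      finally show ?thesis .
    next
      case 3
      have "1 \<le> exp \<bar>s\<bar>" "\<bar>s\<bar> \<le> exp \<bar>s\<bar>"
        using exp_ge_add_one_self[of "\<bar>s\<bar>"] by linarith+
      then have "\<bar>\<phi> 0\<bar> * 1 \<le> \<bar>\<phi> 0\<bar> * exp \<bar>s\<bar>" "\<bar>a\<bar> * \<bar>s\<bar> \<le> \<bar>a\<bar> * exp \<bar>s\<bar>"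
        by (intro mult_left_mono; simp)+
      moreover have "\<bar>\<phi> s - \<phi> 0 - a * s\<bar> \<le> \<bar>\<phi> s\<bar> + \<bar>\<phi> 0\<bar> + \<bar>a * s\<bar>" by linarith
      ultimately have "\<bar>\<phi> s - \<phi> 0 - a * s\<bar> \<le> c * exp \<bar>s\<bar>"
        using bound[of s] unfolding c_def abs_mult by (simp add: algebra_simps)
      also have "\<dots> = c / d\<^sup>2 * d\<^sup>2 * exp \<bar>s\<bar>" using d(1) by simp
      also have "\<dots> \<le> K * s\<^sup>2 * exp \<bar>s\<bar>"
        using 3 c d(1) by (intro mult_mono) (auto simp: K_def abs_le_square_iff[symmetric])
      finally show ?thesis .
    qed
  qed
  moreover have "K \<ge> 0" using c by (simp add: K_def)
  ultimately show thesis by (rule that)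
qed

text \<open>
  The linear term of the expansion has mean zero and the quadratic one has mean \<open>l\<close>, the second
  moment being 1. The rescaled remainder at \<open>x / n\<close> is dominated by \<open>2 K exp (2 |x|)\<close>.
\<close>

lemma gauss_second_order:
  fixes \<phi> :: "real \<Rightarrow> real"
  assumes meas [measurable]: "\<phi> \<in> borel_measurable borel"
    and lim: "((\<lambda>s. (\<phi> s - \<phi> 0 - a * s) / s\<^sup>2) \<longlongrightarrow> l) (at 0)"
    and bound: "\<And>s. \<bar>\<phi> s\<bar> \<le> C * exp \<bar>s\<bar>"
  shows "(\<lambda>n. (real (Suc n))\<^sup>2 * ((\<integral>x. \<phi> (x / real (Suc n)) \<partial>std_gauss) - \<phi> 0)) \<longlonglongrightarrow> l"
proof -
  obtain K where K: "\<And>s. \<bar>\<phi> s - \<phi> 0 - a * s\<bar> \<le> K * s\<^sup>2 * exp \<bar>s\<bar>" "K \<ge> 0"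
    using remainder_bound[OF lim bound] by blast
  have C: "C \<ge> 0" using bound[of 0] by simp
  define r where "r n = real (Suc n)" for n
  \<comment> \<open>The remainder of first order, rescaled to have a nontrivial limit.\<close>
  define R where "R n x = (r n)\<^sup>2 * (\<phi> (x / r n) - \<phi> 0 - a * (x / r n))" for n x
  have r: "r n \<ge> 1" for n by (simp add: r_def)
  have scale: "\<bar>x / r n\<bar> \<le> \<bar>x\<bar>" for x n
    using r[of n] by (simp add: abs_divide divide_le_eq mult_le_cancel_left1)
  have [measurable]: "R n \<in> borel_measurable borel" for n unfolding R_def by measurable
  have "(\<lambda>n. \<integral>x. R n x \<partial>std_gauss) \<longlonglongrightarrow> (\<integral>x. l * x\<^sup>2 \<partial>std_gauss)"
  proof (rule integral_dominated_convergence)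
    show "integrable std_gauss (\<lambda>x. 2 * K * exp (2 * \<bar>x\<bar>))"
      by (intro integrable_mult_right integrable_exp_abs_std_gauss)
    have "(\<lambda>n. R n x) \<longlonglongrightarrow> l * x\<^sup>2" for x
    proof (cases "x = 0")
      case True
      then show ?thesis by (simp add: R_def)
    next
      case False
      have "(\<lambda>n. x / r n) \<longlonglongrightarrow> 0" unfolding r_def by real_asymp
      moreover have "x / r n \<noteq> 0" for n using False r[of n] by simp
      ultimately have "filterlim (\<lambda>n. x / r n) (at 0) sequentially"
        by (simp add: filterlim_at)
      from tendsto_mult_right[OF filterlim_compose[OF lim this], of "x\<^sup>2"]
      have "(\<lambda>n. (\<phi> (x / r n) - \<phi> 0 - a * (x / r n)) / (x / r n)\<^sup>2 * x\<^sup>2) \<longlonglongrightarrow> l * x\<^sup>2" .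
      moreover have "(\<phi> (x / r n) - \<phi> 0 - a * (x / r n)) / (x / r n)\<^sup>2 * x\<^sup>2 = R n x" for n
        using False r[of n] by (simp add: R_def power_divide)
      ultimately show ?thesis by simp
    qed
    then show "AE x in std_gauss. (\<lambda>n. R n x) \<longlonglongrightarrow> l * x\<^sup>2" by simp
    fix n
    have "\<bar>R n x\<bar> \<le> 2 * K * exp (2 * \<bar>x\<bar>)" for x
    proof -
      have "\<bar>R n x\<bar> \<le> (r n)\<^sup>2 * (K * (x / r n)\<^sup>2 * exp \<bar>x / r n\<bar>)"
        unfolding R_def abs_mult using K(1)[of "x / r n"] by (intro mult_mono) auto
      also have "\<dots> = K * (x\<^sup>2 * exp \<bar>x / r n\<bar>)" using r[of n] by (simp add: power_divide)
      also have "\<dots> \<le> K * (2 * exp \<bar>x\<bar> * exp \<bar>x\<bar>)"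
        using scale[of x n] K(2) square_le_exp_abs[of x] by (intro mult_left_mono mult_mono) auto
      also have "\<dots> = 2 * K * exp (2 * \<bar>x\<bar>)" by (simp add: exp_double power2_eq_square)
      finally show ?thesis .
    qed
    then show "AE x in std_gauss. norm (R n x) \<le> 2 * K * exp (2 * \<bar>x\<bar>)" by simp
  qed measurable
  moreover have "(\<integral>x. l * x\<^sup>2 \<partial>std_gauss) = l" by (simp add: std_gauss_moments)
  moreover have "(\<integral>x. R n x \<partial>std_gauss) = (r n)\<^sup>2 * ((\<integral>x. \<phi> (x / r n) \<partial>std_gauss) - \<phi> 0)" for n
  proof -
    have "\<bar>\<phi> (x / r n)\<bar> \<le> C * exp (1 * \<bar>x\<bar>)" for x
      using bound[of "x / r n"] scale[of x n] C by (elim order.trans) (simp add: mult_left_mono)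
    then have "norm (\<phi> (x / r n)) \<le> norm (C * exp (1 * \<bar>x\<bar>))" for x
      using C by (simp add: abs_mult)
    then have i: "integrable std_gauss (\<lambda>x. \<phi> (x / r n))"
      by (intro Bochner_Integration.integrable_bound[OF integrable_mult_right[OF integrable_exp_abs_std_gauss]])
         (measurable, blast)
    have i1: "integrable std_gauss (\<lambda>x. a / r n * x)"
      by (intro integrable_mult_right std_gauss_moments)
    have "(\<integral>x. R n x \<partial>std_gauss) = (r n)\<^sup>2 * (\<integral>x. \<phi> (x / r n) - \<phi> 0 - a / r n * x \<partial>std_gauss)"
      unfolding R_def by simp
    also have "(\<integral>x. \<phi> (x / r n) - \<phi> 0 - a / r n * x \<partial>std_gauss) = (\<integral>x. \<phi> (x / r n) \<partial>std_gauss) - \<phi> 0"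
      using i i1 std_gauss.prob_space std_gauss_moments(2) by simp
    finally show ?thesis .
  qed
  ultimately show ?thesis by (simp only: r_def)
qed

section \<open>Second-order expansion of generalized means\<close>

text \<open>
  At \<open>s = 0\<close> the modulus \<open>\<rho>(s) = |t + s b|\<close> has derivative \<open>Re b\<close> and second derivative
  \<open>(Im b)\<^sup>2 / t\<close>, and \<open>(G \<circ> \<rho>)'' = G''(\<rho>) \<rho>'\<^sup>2 + G'(\<rho>) \<rho>''\<close>.
\<close>

lemma norm_curve_expansion:
  fixes b :: complex and t :: real
  assumes t: "t > 0"
    and G1: "\<And>u. u > 0 \<Longrightarrow> (G has_real_derivative G' u) (at u)"
    and G2: "(G' has_real_derivative G2) (at t)"
  shows "((\<lambda>s. (G (cmod (of_real t + of_real s * b)) - G t - G' t * Re b * s) / s\<^sup>2)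
           \<longlongrightarrow> (G2 * (Re b)\<^sup>2 + G' t * (Im b)\<^sup>2 / t) / 2) (at 0)"
proof -
  define q where "q s = (t + s * Re b)\<^sup>2 + (s * Im b)\<^sup>2" for s
  define \<rho> where "\<rho> s = sqrt (q s)" for s
  define \<rho>' where "\<rho>' s = ((t + s * Re b) * Re b + s * (Im b)\<^sup>2) / \<rho> s" for s
  have \<rho>_eq: "cmod (of_real t + of_real s * b) = \<rho> s" for s
    by (simp add: \<rho>_def q_def cmod_def)
  have \<rho>0: "\<rho> 0 = t" using t by (simp add: \<rho>_def q_def)
  have \<rho>'0: "\<rho>' 0 = Re b" using t by (simp add: \<rho>'_def \<rho>0)
  have "isCont q 0" unfolding q_def by (intro continuous_intros)
  moreover have "q 0 > 0" using t by (simp add: q_def)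
  ultimately have pos: "eventually (\<lambda>s. q s > 0) (nhds 0)"
    by (metis order_tendstoD(1) continuous_within tendsto_at_iff_tendsto_nhds)
  have d\<rho>: "(\<rho> has_real_derivative \<rho>' s) (at s)" if "q s > 0" for s
  proof -
    \<comment> \<open>Half the derivative of \<open>q\<close>, named to keep it from being expanded.\<close>
    define e where "e = (t + s * Re b) * Re b + s * (Im b)\<^sup>2"
    have "(q has_real_derivative 2 * e) (at s)"
      unfolding q_def e_def
      by (auto intro!: derivative_eq_intros simp: power2_eq_square algebra_simps)
    from DERIV_chain2[OF DERIV_real_sqrt[OF that] this]
    have "((\<lambda>s. sqrt (q s)) has_real_derivative inverse (sqrt (q s)) / 2 * (2 * e)) (at s)" .
    moreover have "inverse (sqrt (q s)) / 2 * (2 * e) = \<rho>' s"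
      unfolding \<rho>'_def \<rho>_def e_def[symmetric] by (simp only: divide_inverse) simp
    moreover have "(\<lambda>s. sqrt (q s)) = \<rho>" unfolding \<rho>_def ..
    ultimately show ?thesis by (simp only:)
  qed
  have "eventually (\<lambda>s. ((\<lambda>s. G (\<rho> s)) has_real_derivative G' (\<rho> s) * \<rho>' s) (at s)) (nhds 0)"
    using pos
  proof eventually_elim
    case (elim s)
    then have "\<rho> s > 0" by (simp add: \<rho>_def)
    from DERIV_chain2[OF G1[OF this] d\<rho>[OF elim]] show ?case .
  qed
  moreover have "((\<lambda>s. G' (\<rho> s) * \<rho>' s) has_real_derivative G2 * (Re b)\<^sup>2 + G' t * (Im b)\<^sup>2 / t) (at 0)"
  proof -
    have d0: "(\<rho> has_real_derivative Re b) (at 0)"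
      using d\<rho>[of 0] \<open>q 0 > 0\<close> \<rho>'0 by simp
    have "((\<lambda>s. (t + s * Re b) * Re b + s * (Im b)\<^sup>2) has_real_derivative (Re b)\<^sup>2 + (Im b)\<^sup>2) (at 0)"
      by (auto intro!: derivative_eq_intros simp: power2_eq_square)
    from DERIV_divide[OF this d0] have "(\<rho>' has_real_derivative (Im b)\<^sup>2 / t) (at 0)"
      unfolding \<rho>'_def using t by (simp add: \<rho>0 field_simps power2_eq_square)
    moreover have "((\<lambda>s. G' (\<rho> s)) has_real_derivative G2 * Re b) (at 0)"
      using DERIV_chain2[OF _ d0, of G' G2] G2 by (simp add: \<rho>0)
    ultimately have "((\<lambda>s. G' (\<rho> s) * \<rho>' s) has_real_derivative
        G2 * Re b * \<rho>' 0 + (Im b)\<^sup>2 / t * G' (\<rho> 0)) (at 0)"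
      by (intro DERIV_mult)
    then show ?thesis by (simp add: \<rho>0 \<rho>'0 power2_eq_square mult_ac)
  qed
  ultimately show ?thesis
    using second_order_peano[of "\<lambda>s. G (\<rho> s)" "\<lambda>s. G' (\<rho> s) * \<rho>' s"]
    by (simp add: \<rho>_eq \<rho>0 \<rho>'0)
qed

lemma strict_mono_on_of_deriv_pos:
  assumes "continuous_on {0..} G" "\<And>u. u > 0 \<Longrightarrow> (G has_real_derivative G' u) (at u)"
    and "\<And>u. u > 0 \<Longrightarrow> G' u > (0::real)"
  shows "strict_mono_on {0..} G"
proof (rule strict_mono_onI)
  fix u v :: real assume uv: "u \<in> {0..}" "v \<in> {0..}" "u < v"
  show "G u < G v"
  proof (rule DERIV_pos_imp_increasing_open[OF uv(3)])
    show "\<exists>y. (G has_real_derivative y) (at x) \<and> y > 0" if "u < x" "x < v" for x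
      using assms(2,3)[of x] that uv by auto
    show "continuous_on {u..v} G"
      using uv by (intro continuous_on_subset[OF assms(1)]) auto
  qed
qed

text \<open>
  The delta method: second-order asymptotics pass through the inverse of \<open>G\<close> and pick up its
  derivative. Caratheodory's form of the derivative avoids dividing by \<open>E n - G t\<close>, which may
  vanish. The range of \<open>G\<close> may be bounded, but only values near \<open>G t\<close> matter.
\<close>

lemma tendsto_scaled_inverse:
  assumes cont: "continuous_on {0..} G" and D: "\<And>u. u > 0 \<Longrightarrow> (G has_real_derivative G' u) (at u)"
    and pos: "\<And>u. u > 0 \<Longrightarrow> G' u > (0::real)" and t: "t > 0"
    and lim: "(\<lambda>n. (real (Suc n))\<^sup>2 * (E n - G t)) \<longlonglongrightarrow> L"
  shows "(\<lambda>n. (real (Suc n))\<^sup>2 * (inv_into {0..} G (E n) - t)) \<longlonglongrightarrow> L / G' t"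
proof -
  let ?g = "inv_into {0..} G"
  have inj: "inj_on G {0..}"
    using strict_mono_on_of_deriv_pos[OF cont D pos] by (rule strict_mono_on_imp_inj_on)
  then have inv: "?g (G u) = u" if "u \<ge> 0" for u using that by simp
  have "(?g has_real_derivative inverse (G' t)) (at (G t))"
    unfolding has_field_derivative_def
  proof (rule has_derivative_inverse_strong[where f = G and x = t and S = "{0<..}" and f' = "(*) (G' t)"])
    show "(G has_derivative (*) (G' t)) (at t)"
      using D[OF t] by (simp add: has_field_derivative_def)
    show "continuous_on {0<..} G" by (rule continuous_on_subset[OF cont]) auto
    show "(*) (G' t) \<circ> (*) (inverse (G' t)) = id"
      using pos[OF t] by (auto simp: fun_eq_iff)
  qed (use t inv in auto)
  then obtain h where h: "\<And>y. ?g y - ?g (G t) = h y * (y - G t)" "isCont h (G t)" "h (G t) = inverse (G' t)"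
    unfolding CARAT_DERIV by blast
  have "(\<lambda>n. 1 / (real (Suc n))\<^sup>2) \<longlonglongrightarrow> 0" by real_asymp
  from tendsto_add[OF tendsto_mult[OF this lim] tendsto_const[of "G t"]]
  have "E \<longlonglongrightarrow> G t" by simp
  then have "(\<lambda>n. h (E n)) \<longlonglongrightarrow> inverse (G' t)"
    using isCont_tendsto_compose[OF h(2)] h(3) by metis
  from tendsto_mult[OF this lim]
  have "(\<lambda>n. h (E n) * ((real (Suc n))\<^sup>2 * (E n - G t))) \<longlonglongrightarrow> L / G' t"
    by (simp add: divide_inverse mult.commute)
  moreover have "h (E n) * ((real (Suc n))\<^sup>2 * (E n - G t)) = (real (Suc n))\<^sup>2 * (?g (E n) - t)" for n
  proof -
    have "?g (E n) - t = h (E n) * (E n - G t)" using h(1)[of "E n"] inv[of t] t by simp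
    then show ?thesis by simp
  qed
  ultimately show ?thesis by (simp only:)
qed

text \<open>
  Both sides of the hypothesis are instances of this limit; the bound \<open>|b| \<le> 1\<close> covers the
  direction \<open>b\<close> of the polynomial as well as the direction \<open>z b\<close> of its image, which may be 0.
\<close>

lemma inv_gauss_second_order:
  fixes G :: "real \<Rightarrow> real" and b :: complex
  assumes C: "C_on 3 G {0<..}" and cont: "continuous_on {0..} G"
    and pos: "\<forall>u>0. 0 < deriv G u" and nonneg: "\<forall>u\<ge>0. 0 \<le> G u"
    and growth: "eventually (\<lambda>u. G u \<le> exp u) at_top"
    and t: "t > 0" and b: "cmod b \<le> 1"
  shows "(\<lambda>n. (real (Suc n))\<^sup>2 *
      (inv_into {0..} G (\<integral>x. G (cmod (of_real t + b / of_nat (Suc n) * of_real (x 0))) \<partial>gauss 1) - t))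
    \<longlonglongrightarrow> (t * deriv (deriv G) t / deriv G t * (Re b)\<^sup>2 + (Im b)\<^sup>2) / (2 * t)"
proof -
  define \<phi> where "\<phi> s = G (cmod (of_real t + of_real s * b))" for s
  have D: "(G has_real_derivative deriv G u) (at u)"
    "(deriv G has_real_derivative deriv (deriv G) u) (at u)" if "u > 0" for u
    using C_on_derivs[OF C] that by auto
  have "continuous_on UNIV \<phi>"
    unfolding \<phi>_def by (rule continuous_on_compose2[OF cont]) (auto intro!: continuous_intros)
  then have meas [measurable]: "\<phi> \<in> borel_measurable borel"
    by (rule borel_measurable_continuous_onI)
  obtain K where K: "\<And>u. u \<ge> 0 \<Longrightarrow> \<bar>G u\<bar> \<le> K * exp u" "K \<ge> 0"
    using abs_le_const_mult_exp[OF cont growth] nonneg by blast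
  have bound: "\<bar>\<phi> s\<bar> \<le> K * exp t * exp \<bar>s\<bar>" for s
  proof -
    have "cmod (of_real t + of_real s * b) \<le> t + \<bar>s\<bar> * cmod b"
      using norm_triangle_ineq[of "of_real t" "of_real s * b"] t by (simp add: norm_mult)
    also have "\<dots> \<le> t + \<bar>s\<bar>" using b mult_left_mono[OF b, of "\<bar>s\<bar>"] by simp
    finally have "K * exp (cmod (of_real t + of_real s * b)) \<le> K * exp (t + \<bar>s\<bar>)"
      using K(2) by (intro mult_left_mono) auto
    with K(1)[of "cmod (of_real t + of_real s * b)"] show ?thesis
      by (simp add: \<phi>_def exp_add)
  qed
  have \<phi>0: "\<phi> 0 = G t" using t by (simp add: \<phi>_def)
  have expansion: "((\<lambda>s. (\<phi> s - \<phi> 0 - deriv G t * Re b * s) / s\<^sup>2)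
      \<longlongrightarrow> (deriv (deriv G) t * (Re b)\<^sup>2 + deriv G t * (Im b)\<^sup>2 / t) / 2) (at 0)"
    using norm_curve_expansion[OF t D(1) D(2)[OF t], of b] unfolding \<phi>0 unfolding \<phi>_def by simp
  have lim: "(\<lambda>n. (real (Suc n))\<^sup>2 * ((\<integral>x. \<phi> (x / real (Suc n)) \<partial>std_gauss) - \<phi> 0))
      \<longlonglongrightarrow> (deriv (deriv G) t * (Re b)\<^sup>2 + deriv G t * (Im b)\<^sup>2 / t) / 2"
    by (rule gauss_second_order[OF meas expansion bound])
  have gauss_eq: "(\<integral>x. \<phi> (x / real (Suc n)) \<partial>std_gauss)
      = (\<integral>x. G (cmod (of_real t + b / of_nat (Suc n) * of_real (x 0))) \<partial>gauss 1)" for n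
  proof -
    have "(\<lambda>x. \<phi> (x / real (Suc n))) \<in> borel_measurable borel" by measurable
    from integral_gauss_1[OF this] show ?thesis
      by (simp add: \<phi>_def mult.commute del: of_nat_Suc)
  qed
  have "(deriv (deriv G) t * (Re b)\<^sup>2 + deriv G t * (Im b)\<^sup>2 / t) / 2 / deriv G t
      = (t * deriv (deriv G) t / deriv G t * (Re b)\<^sup>2 + (Im b)\<^sup>2) / (2 * t)"
    using pos[rule_format, OF t] t by (simp add: field_simps)
  then show ?thesis
    using tendsto_scaled_inverse[OF cont D(1) pos[rule_format] t lim[unfolded gauss_eq \<phi>0]] by metis
qed

section \<open>From quadratic forms to the pointwise inequality\<close>

text \<open>
  The worst \<open>b\<close> is a square root of \<open>- cnj A / |A|\<close>, for which \<open>b\<^sup>2 A = - |A|\<close>.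
\<close>

lemma norm_le_of_Re_square_mult:
  fixes A :: complex and r :: real
  assumes "\<And>b. cmod b = 1 \<Longrightarrow> 0 \<le> r + Re (b\<^sup>2 * A)"
  shows "cmod A \<le> r"
proof (cases "A = 0")
  case True
  then show ?thesis using assms[of 1] by simp
next
  case False
  define b where "b = csqrt (- cnj A / of_real (cmod A))"
  have b2: "b\<^sup>2 = - cnj A / of_real (cmod A)" by (simp add: b_def)
  have "(cmod b)\<^sup>2 = 1"
    unfolding norm_power[symmetric] b2 using False by (simp add: norm_divide)
  then have "cmod b = 1" by (simp add: power2_eq_1_iff) (smt (verit) norm_ge_zero)
  moreover have "b\<^sup>2 * A = - (A * cnj A) / of_real (cmod A)" by (simp add: b2)
  then have "b\<^sup>2 * A = - of_real (cmod A)"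
    using False by (simp add: complex_norm_square[symmetric] power2_eq_square)
  ultimately show ?thesis using assms[of b] by simp
qed

lemma quadratic_forms_imp_norm_le:
  fixes p q :: real and z :: complex
  assumes "\<And>b. cmod b = 1 \<Longrightarrow>
    q * (Re (z * b))\<^sup>2 + (Im (z * b))\<^sup>2 \<le> p * (Re b)\<^sup>2 + (Im b)\<^sup>2"
  shows "cmod (of_real p - z\<^sup>2 * of_real q + z\<^sup>2 - 1) \<le> p - (cmod z)\<^sup>2 * q + 1 - (cmod z)\<^sup>2"
proof (rule norm_le_of_Re_square_mult)
  fix b :: complex assume b: "cmod b = 1"
  have Re2: "2 * (Re w)\<^sup>2 = (cmod w)\<^sup>2 + Re (w\<^sup>2)" and Im2: "2 * (Im w)\<^sup>2 = (cmod w)\<^sup>2 - Re (w\<^sup>2)"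
    for w :: complex
    by (simp_all add: cmod_power2 Re_power2)
  have "q * (2 * (Re (z * b))\<^sup>2) + 2 * (Im (z * b))\<^sup>2 \<le> p * (2 * (Re b)\<^sup>2) + 2 * (Im b)\<^sup>2"
    using assms[OF b] by (simp add: algebra_simps)
  then have "q * ((cmod z)\<^sup>2 + Re ((z * b)\<^sup>2)) + ((cmod z)\<^sup>2 - Re ((z * b)\<^sup>2))
      \<le> p * (1 + Re (b\<^sup>2)) + (1 - Re (b\<^sup>2))"
    unfolding Re2 Im2 by (simp add: norm_mult b)
  moreover have "Re (b\<^sup>2 * (of_real p - z\<^sup>2 * of_real q + z\<^sup>2 - 1))
      = p * Re (b\<^sup>2) - q * Re ((z * b)\<^sup>2) + Re ((z * b)\<^sup>2) - Re (b\<^sup>2)"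
  proof -
    have "b\<^sup>2 * (of_real p - z\<^sup>2 * of_real q + z\<^sup>2 - 1)
      = of_real p * b\<^sup>2 - of_real q * (z * b)\<^sup>2 + (z * b)\<^sup>2 - b\<^sup>2"
      by (simp add: algebra_simps power_mult_distrib)
    then show ?thesis by (simp only: minus_complex.sel plus_complex.sel times_complex.sel Re_complex_of_real Im_complex_of_real mult_zero_left diff_0_right)
  qed
  ultimately show "0 \<le> p - (cmod z)\<^sup>2 * q + 1 - (cmod z)\<^sup>2
      + Re (b\<^sup>2 * (of_real p - z\<^sup>2 * of_real q + z\<^sup>2 - 1))"
    by (simp add: algebra_simps)
qed

theorem mainTheorem2:
  fixes P Q :: "real \<Rightarrow> real" and z :: complex
  assumes "C_on 3 P {0<..}" and "continuous_on {0..} P"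
    and "C_on 3 Q {0<..}" and "continuous_on {0..} Q"
    and "\<forall>t\<ge>0. 0 \<le> P t" and "\<forall>t\<ge>0. 0 \<le> Q t"
    and "\<forall>t>0. 0 < deriv P t" and "\<forall>t>0. 0 < deriv Q t"
    and "P 0 = 0" and "filterlim P at_top at_top"
    and "growth_condition P"
    and "growth_condition (Q \<circ> inv_into {0..} P)"
    and "cmod z \<le> 1"
    and "\<forall>k\<ge>1. \<forall>f. poly_fun k f \<longrightarrow>
      inv_into {0..} Q (\<integral>x. Q (cmod (T_op k z f x)) \<partial>gauss k)
        \<le> inv_into {0..} P (\<integral>x. P (cmod (f x)) \<partial>gauss k)"
  shows "\<forall>t>0.
    cmod (of_real (t * deriv (deriv P) t / deriv P t)
          - z\<^sup>2 * of_real (t * deriv (deriv Q) t / deriv Q t) + z\<^sup>2 - 1)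
      \<le> t * deriv (deriv P) t / deriv P t
          - (cmod z)\<^sup>2 * (t * deriv (deriv Q) t / deriv Q t) + 1 - (cmod z)\<^sup>2"
proof (intro allI impI quadratic_forms_imp_norm_le)
  fix t :: real and b :: complex
  assume t: "t > 0" and b: "cmod b = 1"
  have growth_P: "eventually (\<lambda>u. P u \<le> exp u) at_top"
    by (rule growth_condition_imp_le_exp) fact
  have inj: "inj_on P {0..}"
    using strict_mono_on_of_deriv_pos[of P "deriv P"] C_on_derivs(1)[OF assms(1)] assms(2,7)
    by (intro strict_mono_on_imp_inj_on) auto
  have "eventually (\<lambda>u. (Q \<circ> inv_into {0..} P) (P u) \<le> exp u) at_top"
    by (rule growth_condition_comp_le_exp) fact+
  with eventually_ge_at_top[of 0] have growth_Q: "eventually (\<lambda>u. Q u \<le> exp u) at_top"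
    by eventually_elim (use inj in simp)
  have "b / of_nat (Suc n) \<noteq> 0" for n
    using b by (auto simp del: of_nat_Suc)
  note T = T_op_affine[OF this]
  have zb: "cmod (z * b) \<le> 1"
    using b assms(13) by (simp add: norm_mult)
  let ?S = "\<lambda>G w n. (real (Suc n))\<^sup>2 *
      (inv_into {0..} G (\<integral>x. G (cmod (of_real t + w / of_nat (Suc n) * of_real (x 0))) \<partial>gauss 1) - t)"
  have limP: "?S P b \<longlonglongrightarrow> (t * deriv (deriv P) t / deriv P t * (Re b)\<^sup>2 + (Im b)\<^sup>2) / (2 * t)"
    using b by (intro inv_gauss_second_order growth_P t assms) simp
  have limQ: "?S Q (z * b) \<longlonglongrightarrow>
      (t * deriv (deriv Q) t / deriv Q t * (Re (z * b))\<^sup>2 + (Im (z * b))\<^sup>2) / (2 * t)"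
    by (intro inv_gauss_second_order growth_Q t assms zb)
  have "?S Q (z * b) n \<le> ?S P b n" for n
  proof -
    let ?f = "\<lambda>x :: nat \<Rightarrow> real. of_real t + b / of_nat (Suc n) * of_real (x 0)"
    have "poly_fun 1 ?f" unfolding poly_fun_def using affine_is_poly_fun by blast
    then have "inv_into {0..} Q (\<integral>x. Q (cmod (T_op 1 z ?f x)) \<partial>gauss 1)
        \<le> inv_into {0..} P (\<integral>x. P (cmod (?f x)) \<partial>gauss 1)"
      using assms(14) by blast
    then show ?thesis unfolding T by (intro mult_left_mono diff_right_mono) (simp_all add: mult.assoc)
  qed
  then have "(t * deriv (deriv Q) t / deriv Q t * (Re (z * b))\<^sup>2 + (Im (z * b))\<^sup>2) / (2 * t)
      \<le> (t * deriv (deriv P) t / deriv P t * (Re b)\<^sup>2 + (Im b)\<^sup>2) / (2 * t)"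
    by (intro LIMSEQ_le[OF limQ limP]) blast
  then show "t * deriv (deriv Q) t / deriv Q t * (Re (z * b))\<^sup>2 + (Im (z * b))\<^sup>2
      \<le> t * deriv (deriv P) t / deriv P t * (Re b)\<^sup>2 + (Im b)\<^sup>2"
    using t by (simp add: divide_le_cancel)
qed

end
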